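(* Let $P$ be a finite poset with $d$ elements, let $K$ be a maximal chain in $\mathcal{F}^{(e)}(P)$, and put $C=\operatorname{supp}(K)$, $\varepsilon=\operatorname{sgn}(K)$. Let $C_1,\dots,C_d$ be the chains of $P$ associated to $C$, and define $$\tilde L^K_i(g)=\sum_{v\in C_i}\varepsilon(v)g(v)\quad(g\in\mathbb{R}^P).$$ Then the face $T^{(e)}_K=\operatorname{conv}\Phi^{(e)}(K)$ of the triangulation $\mathcal{T}^{(e)}_P$ of $\mathcal{C}^{(e)}(P)$ is given by $$T^{(e)}_K=\{g\in\mathbb{R}^P : 0\le\tilde L^K_1(g)\le\tilde L^K_2(g)\le\dots\le\tilde L^K_d(g)\le 1\}.$$
   Context: For $f\in\mathbb{R}^P$ (real-valued functions on $P$), $\operatorname{supp}(f)=\{v\in P: f(v)\neq 0\}$. An order filter of $P$ is a subset $F\subset P$ such that $v\in F$ and $v<w$ imply $w\in F$; $v\lessdot w$ means $w$ covers $v$. $\mathcal{F}^{(e)}(P)$ is the set of $f:P\to\{1,0,-1\}$ such that $\operatorname{supp}(f)$ is an order filter of $P$, and if $f(v)=-1$ then $v$ is minimal in $\operatorname{supp}(f)$. It is partially ordered: $f>g$ if (i) $\operatorname{supp}(f)\supsetneq\operatorname{supp}(g)$; (ii) $f(v)\ge g(v)$ for any $v\in\operatorname{supp}(g)$; (iii) if $v\in\operatorname{supp}(g)$ and $v$ is minimal in $\operatorname{supp}(f)$, then $f(v)=g(v)$. $\mathcal{C}^{(e)}(P)$ is the convex hull of the set of functions $P\to\{1,0,-1\}$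 whose support is an antichain. The enriched transfer map $\Phi^{(e)}:\mathbb{R}^P\to\mathbb{R}^P$ is defined inductively by $(\Phi^{(e)}f)(v)=f(v)$ if $v$ is minimal in $P$, and $(\Phi^{(e)}f)(v)=f(v)-\max\{\sum_{i=1}^r|(\Phi^{(e)}f)(v_i)| : v>v_1>\dots>v_r \text{ a chain in } P\}$ otherwise. $\mathcal{T}^{(e)}_P=\{\operatorname{conv}\Phi^{(e)}(K): K\text{ a chain in }\mathcal{F}^{(e)}(P)\}$, which is a triangulation of $\mathcal{C}^{(e)}(P)$. For a chain $K=\{f_1>\dots>f_k\}$ of $\mathcal{F}^{(e)}(P)$: $\operatorname{supp}(K)$ is the chain of order filters $\{\operatorname{supp}(f_1)\supsetneq\dots\supsetneq\operatorname{supp}(f_k)\}$, and $\operatorname{sgn}(K)$ is the map $\varphi:P\to\{1,0,-1\}$ with $\varphi(v)=0$ if $v$ is not minimal in $\operatorname{supp}(f_i)$ for any $i$, and $\varphi(v)=f_i(v)$ if $v$ is minimal in $\operatorname{supp}(f_i)$ for some $i$ (this is independent of the choice of $i$). If $K$ is maximal, then $\operatorname{supp}(K)$ is a maximal chain of order filters and $\operatorname{sgn}(K)$ takes values in $\{1,-1\}$. To a maximal chain $C=\{F_0\supsetneq F_1\supsetneq\dots\supsetneq F_d\}$ of order filters of $P$ one associates a linear extension $(v_1,\dots,v_d)$ of $P$, defined by $F_{i-1}=F_i\cup\{v_i\}$ ($i=1,\dots,d$), and chains $C_1,\dots,C_d$ of $P$, defined inductively: $C_i=\{v_i\}$ if $v_i$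 is minimal in $P$; otherwise $C_i=\{v_i\}\cup C_j$, where $j$ is the largest index satisfying $v_j\lessdot v_i$. *)

theory Defs
  imports "HOL-Analysis.Analysis"
begin

text \<open>
  The finite poset is the index type \<open>'a\<close> of sort \<open>{finite, order}\<close>, and the space of
  real-valued functions on it is \<open>real ^ 'a\<close>. Chains and maximal chains are those of
  \<^locale>\<open>pred_on\<close>, which takes the ambient set and the strict order as parameters; the direction
  of the order is immaterial.
\<close>

definition order_filter :: "'a::order set \<Rightarrow> bool" where
  "order_filter F \<longleftrightarrow> (\<forall>v w. v \<in> F \<and> v < w \<longrightarrow> w \<in> F)"

definition minimal_in :: "'a::order set \<Rightarrow> 'a \<Rightarrow> bool" where
  "minimal_in S v \<longleftrightarrow> v \<in> S \<and> \<not> (\<exists>w\<in>S. w < v)"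

definition covered_by :: "'a::order \<Rightarrow> 'a \<Rightarrow> bool"  (infix "\<lessdot>" 50) where
  "v \<lessdot> w \<longleftrightarrow> v < w \<and> \<not> (\<exists>u. v < u \<and> u < w)"

definition supp :: "real ^ 'a::finite \<Rightarrow> 'a set" where
  "supp f = {v. f $ v \<noteq> 0}"

definition enriched_filters :: "(real ^ 'a::{finite, order}) set" where
  "enriched_filters =
     {f. (\<forall>v. f $ v \<in> {1, 0, -1}) \<and> order_filter (supp f) \<and>
         (\<forall>v. f $ v = -1 \<longrightarrow> minimal_in (supp f) v)}"

definition enriched_greater :: "real ^ 'a::{finite, order} \<Rightarrow> real ^ 'a::{finite, order} \<Rightarrow> bool"
  (infix "\<succ>" 50) where
  "f \<succ> g \<longleftrightarrow>
     supp g \<subset> supp f \<and>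
     (\<forall>v \<in> supp g. g $ v \<le> f $ v) \<and>
     (\<forall>v \<in> supp g. minimal_in (supp f) v \<longrightarrow> f $ v = g $ v)"

lemma card_lessThan_strict_mono:
  fixes v w :: "'a::{finite, order}"
  assumes "w < v"
  shows "card {..<w} < card {..<v}"
proof (rule psubset_card_mono)
  show "{..<w} \<subset> {..<v}"
    using assms by (metis lessThan_iff less_irrefl less_trans psubsetI subsetI)
qed simp

text \<open>
  In the maximum, a chain \<open>v > v\<^sub>1 > \<dots> > v\<^sub>r\<close> with \<open>r \<ge> 1\<close> is represented by the set
  \<open>{v\<^sub>1, \<dots>, v\<^sub>r}\<close>.
\<close>

function transfer_at :: "real ^ 'a::{finite, order} \<Rightarrow> 'a \<Rightarrow> real" where
  "transfer_at f v =
     (if minimal_in UNIV v then f $ v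
      else f $ v - Max ((\<lambda>D. \<Sum>w\<in>D. \<bar>transfer_at f w\<bar>) `
                          {D. D \<noteq> {} \<and> pred_on.chain {..<v} (<) D}))"
  by pat_completeness auto
termination
proof (relation "Wellfounded.measure (\<lambda>(f, v). card {..<v})")
  fix f :: "real ^ 'a::{finite, order}" and v w and D :: "'a set"
  assume "D \<in> {D. D \<noteq> {} \<and> pred_on.chain {..<v} (<) D}" and "w \<in> D"
  then have "w < v"
    unfolding pred_on.chain_def by blast
  then show "((f, w), (f, v)) \<in> Wellfounded.measure (\<lambda>(f, v). card {..<v})"
    by (simp add: card_lessThan_strict_mono)
qed simp

declare transfer_at.simps [simp del]

definition enriched_transfer :: "real ^ 'a::{finite, order} \<Rightarrow> real ^ 'a::{finite, order}" where
  "enriched_transfer f = (\<chi> v. transfer_at f v)"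

definition enriched_face :: "(real ^ 'a::{finite, order}) set \<Rightarrow> (real ^ 'a::{finite, order}) set" where
  "enriched_face K = convex hull (enriched_transfer ` K)"

definition enriched_triangulation :: "(real ^ 'a::{finite, order}) set set" where
  "enriched_triangulation =
     {enriched_face K | K. pred_on.chain enriched_filters (\<succ>) K}"

definition chain_supp :: "(real ^ 'a::{finite, order}) set \<Rightarrow> 'a set set" where
  "chain_supp K = supp ` K"

definition chain_sgn :: "(real ^ 'a::{finite, order}) set \<Rightarrow> 'a \<Rightarrow> real" where
  "chain_sgn K v =
     (if \<exists>f\<in>K. minimal_in (supp f) v
      then THE s. \<exists>f\<in>K. minimal_in (supp f) v \<and> s = f $ v
      else 0)"

text \<open>
  The \<open>i\<close>-th member, counting from 0, of a chain of sets listed in strictly decreasing order: the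
  one with exactly \<open>i\<close> members strictly above it.
\<close>

definition nth_filter :: "'a set set \<Rightarrow> nat \<Rightarrow> 'a set" where
  "nth_filter C i = (THE F. F \<in> C \<and> card {G \<in> C. F \<subset> G} = i)"

text \<open>Indexed by \<open>1 \<le> i \<le> CARD('a)\<close>.\<close>

definition lin_ext :: "'a set set \<Rightarrow> nat \<Rightarrow> 'a" where
  "lin_ext C i = (THE v. nth_filter C (i - 1) = nth_filter C i \<union> {v})"

text \<open>
  The disjunct for an empty index set only makes the recursion total: if \<open>v\<close> enumerates the poset,
  it holds exactly when \<open>v i\<close> is minimal.
\<close>

function assoc_chain :: "(nat \<Rightarrow> 'a::{finite, order}) \<Rightarrow> nat \<Rightarrow> 'a set" where
  "assoc_chain v i =
     (if minimal_in UNIV (v i) \<or> {j \<in> {1..CARD('a)}. v j \<lessdot> v i} = {} then {v i}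
      else {v i} \<union> assoc_chain v (Max {j \<in> {1..CARD('a)}. v j \<lessdot> v i}))"
  by pat_completeness auto
termination
proof (relation "Wellfounded.measure (\<lambda>(v, i). card {..<v i})")
  fix v :: "nat \<Rightarrow> 'a" and i
  let ?J = "{j \<in> {1..CARD('a)}. v j \<lessdot> v i}"
  assume "\<not> (minimal_in UNIV (v i) \<or> ?J = {})"
  then have "Max ?J \<in> ?J"
    by (intro Max_in) (simp, blast)
  then have "v (Max ?J) \<lessdot> v i"
    by blast
  then have "v (Max ?J) < v i"
    unfolding covered_by_def by (rule conjunct1)
  then show "((v, Max ?J), (v, i)) \<in> Wellfounded.measure (\<lambda>(v, i). card {..<v i})"
    unfolding in_measure prod.case by (rule card_lessThan_strict_mono)
qed simp

declare assoc_chain.simps [simp del]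

definition L_tilde :: "(real ^ 'a::{finite, order}) set \<Rightarrow> nat \<Rightarrow>
    real ^ 'a::{finite, order} \<Rightarrow> real" where
  "L_tilde K i g =
     (\<Sum>v \<in> assoc_chain (lin_ext (chain_supp K)) i. chain_sgn K v * g $ v)"

end

theory Submission
  imports Defs
begin

text \<open>
  On an enriched filter \<open>f\<close> the transfer map keeps the values at the minimal elements of the
  support and kills all others. A maximal chain \<open>K = {f\<^sub>0 \<succ> \<dots> \<succ> f\<^sub>d}\<close> has supports of all sizes,
  \<open>supp f\<^sub>k = {v\<^sub>k\<^sub>+\<^sub>1, \<dots>, v\<^sub>d}\<close>: if \<open>f \<succ> g\<close>, extending \<open>g\<close> by a maximal element \<open>v\<close> of
  \<open>supp f - supp g\<close> with value \<open>f v\<close>, and raising the values above \<open>v\<close> to 1, gives an enriched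
  filter that fits between them. Further, each associated chain \<open>C\<^sub>i\<close> with \<open>i > k\<close> meets the minimal
  elements of \<open>supp f\<^sub>k\<close> exactly once, while it misses \<open>supp f\<^sub>k\<close> for \<open>i \<le> k\<close>. Hence the value of
  the \<open>i\<close>-th functional at the \<open>k\<close>-th vertex is 1 if \<open>i > k\<close> and 0 otherwise. The functionals are
  triangular with diagonal \<open>\<plusminus>1\<close> in the coordinates \<open>v\<^sub>1, \<dots>, v\<^sub>d\<close>, hence jointly injective, and the
  barycentric coordinates of \<open>g\<close> are the successive differences of \<open>0, L\<^sub>1 g, \<dots>, L\<^sub>d g, 1\<close>.
\<close>

section \<open>The transfer map on enriched filters\<close>

lemma ex_minimal_in_le:
  fixes w :: "'a::{finite, order}"
  assumes "w \<in> S"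
  obtains u where "minimal_in S u" "u \<le> w"
  using finite_has_minimal2[of S w] assms unfolding minimal_in_def
  by (metis finite_code order_less_le)

lemma ex_covered_by:
  fixes u w :: "'a::{finite, order}"
  assumes "u < w"
  obtains x where "x \<lessdot> w" "u \<le> x"
proof -
  obtain x where "x \<in> {u..<w}" and max: "\<And>y. y \<in> {u..<w} \<Longrightarrow> x \<le> y \<Longrightarrow> x = y"
    using finite_has_maximal2[of "{u..<w}" u] assms by auto
  then show thesis
    using that[of x] unfolding covered_by_def
    by (metis atLeastLessThan_iff order.strict_trans1 order_less_imp_le order_less_irrefl)
qed

text \<open>Of two distinct members of a chain the upper one cannot be minimal. Sums over a chain of
  terms supported on minimal elements thus have at most one nonzero term.\<close>

lemma minimal_in_chain_unique:
  assumes "pred_on.chain A (<) D" "x \<in> D" "y \<in> D" "minimal_in S x" "minimal_in S y"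
  shows "x = y"
  using assms unfolding pred_on.chain_def minimal_in_def by simp blast

lemma enriched_filters_D:
  assumes "f \<in> enriched_filters"
  shows "order_filter (supp f)"
    and "f $ v \<in> {1, 0, -1}"
    and "minimal_in (supp f) v \<Longrightarrow> \<bar>f $ v\<bar> = 1"
    and "v \<in> supp f \<Longrightarrow> \<not> minimal_in (supp f) v \<Longrightarrow> f $ v = 1"
proof -
  show "order_filter (supp f)" and v: "f $ v \<in> {1, 0, -1}"
    using assms unfolding enriched_filters_def by auto
  show "\<bar>f $ v\<bar> = 1" if "minimal_in (supp f) v"
    using v that by (auto simp: minimal_in_def supp_def)
  show "f $ v = 1" if "v \<in> supp f" "\<not> minimal_in (supp f) v"
    using assms that v unfolding enriched_filters_def by (auto simp: supp_def)
qed

text \<open>Induction along the poset: below \<open>v\<close> the transferred values have absolute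
  value 1 at minimal elements of the support and 0 elsewhere, so every chain sum is 0 or 1. The
  maximum is 1 exactly when \<open>v\<close> lies strictly above such an element, and there it
  cancels \<open>f $ v = 1\<close>.\<close>

lemma transfer_at_enriched:
  fixes f :: "real ^ 'a::{finite, order}"
  assumes "f \<in> enriched_filters"
  shows "transfer_at f v = (if minimal_in (supp f) v then f $ v else 0)"
proof (induction "card {..<v}" arbitrary: v rule: less_induct)
  case less
  note f = enriched_filters_D[OF assms]
  let ?m = "minimal_in (supp f)"
  have IH: "\<bar>transfer_at f w\<bar> = (if ?m w then 1 else 0)" if "w < v" for w
    using less[OF card_lessThan_strict_mono[OF that]] f(3)[of w] by simp
  show ?case
  proof (cases "minimal_in UNIV v")
    case True
    then show ?thesis
      by (subst transfer_at.simps) (auto simp: minimal_in_def supp_def)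
  next
    case False
    let ?D = "{D. D \<noteq> {} \<and> pred_on.chain {..<v} (<) D}"
    let ?s = "\<lambda>D. \<Sum>w\<in>D. \<bar>transfer_at f w\<bar>"
    let ?b = "if v \<in> supp f \<and> \<not> ?m v then 1 else 0 :: real"
    have s: "?s D = (if \<exists>w\<in>D. ?m w then 1 else 0)" if "D \<in> ?D" for D
    proof -
      have sub: "D \<subseteq> {..<v}"
        using that unfolding pred_on.chain_def by blast
      have "?s D = (\<Sum>w\<in>D. if ?m w then 1 else 0)"
        using sub by (intro sum.cong refl) (rule IH, blast)
      also have "\<dots> = (if \<exists>w\<in>D. ?m w then 1 else 0)"
      proof (cases "\<exists>w\<in>D. ?m w")
        case True
        then obtain x where x: "x \<in> D" "?m x"
          by blast
        then have "?m w \<longleftrightarrow> w = x" if "w \<in> D" for w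
          using minimal_in_chain_unique that \<open>D \<in> ?D\<close> by blast
        then have "(\<Sum>w\<in>D. if ?m w then 1 else 0 :: real) = (\<Sum>w\<in>D. if w = x then 1 else 0)"
          by (intro sum.cong) auto
        then show ?thesis
          using x by auto
      qed (auto intro: sum.neutral)
      finally show ?thesis .
    qed
    have below: "w < v \<Longrightarrow> ?m w \<Longrightarrow> v \<in> supp f \<and> \<not> ?m v" for w
      using f(1) unfolding order_filter_def minimal_in_def by blast
    have "Max (?s ` ?D) = ?b"
    proof (rule Max_eqI)
      show "finite (?s ` ?D)"
        by simp
      show "y \<le> ?b" if y: "y \<in> ?s ` ?D" for y
      proof -
        obtain D where D: "y = ?s D" "D \<in> ?D"
          using y by (rule imageE)
        have "D \<subseteq> {..<v}"
          using D(2) unfolding pred_on.chain_def by blast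
        then show ?thesis
          using s[OF D(2)] D(1) below by auto
      qed
      \<comment> \<open>The singleton \<open>{u}\<close> attains the maximum: \<open>u\<close> is a
        minimal element of the support if one lies below \<open>v\<close>, and otherwise any element
        below \<open>v\<close>, whose term is 0.\<close>
      obtain u where u: "u < v" "v \<in> supp f \<and> \<not> ?m v \<Longrightarrow> ?m u"
      proof (cases "v \<in> supp f \<and> \<not> ?m v")
        case True
        then obtain w where "w < v" "w \<in> supp f"
          by (auto simp: minimal_in_def)
        moreover obtain u where "minimal_in (supp f) u" "u \<le> w"
          using ex_minimal_in_le \<open>w \<in> supp f\<close> .
        ultimately show ?thesis
          using that[of u] by simp
      next
        case nm: False
        show ?thesis
          using that False nm unfolding minimal_in_def by blast
      qed
      have D: "{u} \<in> ?D"
        using u(1) by (auto simp: pred_on.chain_def)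
      have "?m u \<longleftrightarrow> v \<in> supp f \<and> \<not> ?m v"
        using u below by blast
      then have "?b = ?s {u}"
        unfolding s[OF D] by (simp only: bex_simps simp_thms)
      then show "?b \<in> ?s ` ?D"
        using D by (rule image_eqI)
    qed
    then show ?thesis
      using False f(4)[of v] by (subst transfer_at.simps) (auto simp: minimal_in_def supp_def)
  qed
qed

section \<open>Maximal chains of enriched filters\<close>

text \<open>For condition (iii): an element of \<open>supp h\<close> that is minimal in
  \<open>supp f\<close> is also minimal in the smaller set \<open>supp g\<close>, which contains
  it.\<close>

lemma enriched_greater_trans:
  assumes "f \<succ> g" "g \<succ> h"
  shows "f \<succ> h"
  using assms unfolding enriched_greater_def minimal_in_def
  by (smt (verit) order_trans psubsetE psubset_trans subset_iff)

text \<open>Beyond the chain property itself, maximality of \<open>K\<close> enters only through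
  this criterion.\<close>

lemma maxchain_memI:
  assumes "pred_on.maxchain A P K" "x \<in> A" "\<And>y. y \<in> K \<Longrightarrow> x = y \<or> P x y \<or> P y x"
  shows "x \<in> K"
proof (rule ccontr)
  assume "x \<notin> K"
  moreover have "pred_on.chain A P (insert x K)"
    using assms unfolding pred_on.maxchain_def pred_on.chain_def by auto
  ultimately show False
    using assms(1) unfolding pred_on.maxchain_def by blast
qed

text \<open>Elements above \<open>v\<close> stop being minimal once \<open>v\<close> joins the
  support, so the value -1 is no longer allowed there.\<close>

definition extend_filter :: "real ^ 'a::{finite, order} \<Rightarrow> 'a \<Rightarrow> real \<Rightarrow> real ^ 'a::{finite, order}" where
  "extend_filter g v s = (\<chi> w. if w = v then s else if v < w then 1 else g $ w)"

lemma extend_filter: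
  fixes g :: "real ^ 'a::{finite, order}"
  assumes g: "g \<in> enriched_filters" and v: "v \<notin> supp g" "\<And>w. v < w \<Longrightarrow> w \<in> supp g"
    and s: "s = 1 \<or> s = -1"
  shows "supp (extend_filter g v s) = insert v (supp g)"
    and "extend_filter g v s \<in> enriched_filters"
    and "extend_filter g v s \<succ> g"
proof -
  let ?h = "extend_filter g v s"
  note gD = enriched_filters_D[OF g]
  show supp: "supp ?h = insert v (supp g)"
    using v s by (auto simp: supp_def extend_filter_def)
  have nbelow: "\<not> w < v" if "w \<in> supp g" for w
    using v(1) gD(1) that unfolding order_filter_def by blast
  have "order_filter (insert v (supp g))"
    using gD(1) v(2) unfolding order_filter_def by blast
  moreover have "?h $ w \<in> {1, 0, -1}" for w
    using gD(2)[of w] s by (auto simp: extend_filter_def)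
  moreover have "minimal_in (insert v (supp g)) w" if "?h $ w = -1" for w
  proof (cases "w = v")
    case True
    then show ?thesis
      using nbelow by (auto simp: minimal_in_def)
  next
    case False
    then have "\<not> v < w" "g $ w = -1"
      using that by (auto simp: extend_filter_def split: if_splits)
    then show ?thesis
      using g by (auto simp: minimal_in_def enriched_filters_def)
  qed
  ultimately show "?h \<in> enriched_filters"
    unfolding enriched_filters_def using supp by auto
  show "?h \<succ> g"
    unfolding enriched_greater_def supp
  proof (intro conjI ballI impI)
    show "supp g \<subset> insert v (supp g)"
      using v by blast
    fix w assume w: "w \<in> supp g"
    show "g $ w \<le> ?h $ w"
      using w v gD(2)[of w] by (auto simp: extend_filter_def)
    show "?h $ w = g $ w" if "minimal_in (insert v (supp g)) w"
      using w v that by (auto simp: extend_filter_def minimal_in_def)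
  qed
qed

text \<open>The value at \<open>v\<close> is \<open>f $ v\<close> because \<open>v\<close> may be
  minimal in \<open>supp f\<close>. Elements above \<open>v\<close> are not minimal in
  \<open>supp f\<close>, so \<open>f\<close> is 1 there, in agreement with the raised
  values.\<close>

lemma greater_extend_filter:
  fixes f g :: "real ^ 'a::{finite, order}"
  assumes f: "f \<in> enriched_filters" and g: "g \<in> enriched_filters" and fg: "f \<succ> g"
    and v: "v \<in> supp f" "v \<notin> supp g" "\<And>w. v < w \<Longrightarrow> w \<in> supp g"
    and ne: "supp f \<noteq> insert v (supp g)"
  shows "f \<succ> extend_filter g v (f $ v)"
proof -
  note fD = enriched_filters_D[OF f]
  have s: "f $ v = 1 \<or> f $ v = -1"
    using v(1) fD(2)[of v] by (auto simp: supp_def)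
  have supp: "supp (extend_filter g v (f $ v)) = insert v (supp g)"
    by (rule extend_filter(1)[OF g v(2,3) s])
  have fgD: "supp g \<subset> supp f" "\<And>w. w \<in> supp g \<Longrightarrow> g $ w \<le> f $ w"
    "\<And>w. w \<in> supp g \<Longrightarrow> minimal_in (supp f) w \<Longrightarrow> f $ w = g $ w"
    using fg unfolding enriched_greater_def by auto
  show ?thesis
    unfolding enriched_greater_def supp
  proof (intro conjI ballI impI)
    show "insert v (supp g) \<subset> supp f"
      using fgD(1) v(1) ne by blast
    fix w assume w: "w \<in> insert v (supp g)"
    have "f $ w = 1" if "v < w"
      using that v(1) v(3)[OF that] fgD(1) by (intro fD(4)) (auto simp: minimal_in_def)
    then show "extend_filter g v (f $ v) $ w \<le> f $ w"
      using w fgD(2) by (auto simp: extend_filter_def)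
    show "f $ w = extend_filter g v (f $ v) $ w" if "minimal_in (supp f) w"
      using w fgD(3) v(1) that by (auto simp: extend_filter_def minimal_in_def)
  qed
qed

section \<open>Supports of the members of a maximal chain\<close>

locale enriched_maxchain =
  fixes K :: "(real ^ 'a::{finite, order}) set" and d :: nat
  assumes card_UNIV_eq [simp]: "CARD('a) = d"
    and maxchain: "pred_on.maxchain enriched_filters (\<succ>) K"
begin

lemma card_le_d: "card (A :: 'a set) \<le> d"
  using card_mono[of UNIV A] by simp

lemma d_ge_1: "1 \<le> d"
  using card_le_d[of "{undefined}"] by simp

lemma K_enriched: "f \<in> K \<Longrightarrow> f \<in> enriched_filters"
  using maxchain unfolding pred_on.maxchain_def pred_on.chain_def by auto

lemma K_comparable: "f \<in> K \<Longrightarrow> g \<in> K \<Longrightarrow> f = g \<or> f \<succ> g \<or> g \<succ> f"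
  using maxchain unfolding pred_on.maxchain_def pred_on.chain_def by auto

lemma supp_greater_iff_card:
  assumes "f \<in> K" "g \<in> K"
  shows "supp g \<subset> supp f \<longleftrightarrow> card (supp g) < card (supp f)"
proof
  show "card (supp g) < card (supp f)" if "supp g \<subset> supp f"
    using that by (simp add: psubset_card_mono)
  show "supp g \<subset> supp f" if "card (supp g) < card (supp f)"
  proof -
    have "f \<noteq> g" "\<not> supp f \<subset> supp g"
      using that psubset_card_mono[of "supp g" "supp f"] by auto
    then show ?thesis
      using K_comparable[OF assms] unfolding enriched_greater_def by blast
  qed
qed

lemma zero_in_K: "0 \<in> K"
proof (rule maxchain_memI[OF maxchain])
  show "0 \<in> enriched_filters"
    by (auto simp: enriched_filters_def supp_def order_filter_def)
  show "0 = f \<or> 0 \<succ> f \<or> f \<succ> 0" if "f \<in> K" for f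
    by (auto simp: enriched_greater_def supp_def vec_eq_iff)
qed

text \<open>A gap of more than one element above \<open>supp g\<close> could be refined by a
  one-element extension comparable with all of \<open>K\<close>, which maximality then places in
  \<open>K\<close>.\<close>

lemma K_successor:
  assumes g: "g \<in> K" and ne: "supp g \<noteq> UNIV"
  obtains h v where "h \<in> K" "v \<notin> supp g" "supp h = insert v (supp g)"
proof (cases "\<exists>f\<in>K. f \<succ> g")
  case False
  obtain v where v: "v \<in> - supp g" "\<And>w. w \<in> - supp g \<Longrightarrow> v \<le> w \<Longrightarrow> v = w"
    using finite_has_maximal[of "- supp g"] ne by auto
  have v': "v \<notin> supp g" "v < w \<Longrightarrow> w \<in> supp g" for w
    using v order_less_le by auto
  \<comment> \<open>With nothing of \<open>K\<close> above \<open>g\<close>, either sign would do at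
    \<open>v\<close>; 1 is an arbitrary choice.\<close>
  let ?h = "extend_filter g v 1"
  note h = extend_filter[OF K_enriched[OF g] v', of 1, simplified]
  have "?h \<in> K"
  proof (rule maxchain_memI[OF maxchain h(2)])
    show "?h = f \<or> ?h \<succ> f \<or> f \<succ> ?h" if "f \<in> K" for f
      using K_comparable[OF that g] False that h(3) enriched_greater_trans by blast
  qed
  then show thesis
    using that h(1) v'(1) by blast
next
  case True
  \<comment> \<open>\<open>f\<close> is the next member of \<open>K\<close> above \<open>g\<close>,
    found by minimizing the size of the support.\<close>
  then obtain f where f: "f \<in> K" "f \<succ> g"
    and min: "\<And>k. k \<in> K \<Longrightarrow> k \<succ> g \<Longrightarrow> card (supp f) \<le> card (supp k)"
    using ex_has_least_nat[of "\<lambda>f. f \<in> K \<and> f \<succ> g" _ "\<lambda>f. card (supp f)"] by blast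
  have sub: "supp g \<subset> supp f"
    using f(2) by (simp add: enriched_greater_def)
  then obtain v where v: "v \<in> supp f - supp g"
    "\<And>w. w \<in> supp f - supp g \<Longrightarrow> v \<le> w \<Longrightarrow> v = w"
    using finite_has_maximal[of "supp f - supp g"] by auto
  note fD = enriched_filters_D[OF K_enriched[OF f(1)]]
  have v': "v \<in> supp f" "v \<notin> supp g" "v < w \<Longrightarrow> w \<in> supp g" for w
    using v fD(1) unfolding order_filter_def order_less_le by auto
  have s: "f $ v = 1 \<or> f $ v = -1"
    using v'(1) fD(2)[of v] by (auto simp: supp_def)
  let ?h = "extend_filter g v (f $ v)"
  note h = extend_filter[OF K_enriched[OF g] v'(2,3) s]
  show thesis
  proof (cases "supp f = insert v (supp g)")
    case True
    then show thesis
      using that f(1) v'(2) by blast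
  next
    case False
    have fh: "f \<succ> ?h"
      by (rule greater_extend_filter[OF K_enriched[OF f(1)] K_enriched[OF g] f(2) v' False])
    have "?h \<in> K"
    proof (rule maxchain_memI[OF maxchain h(2)])
      fix k assume k: "k \<in> K"
      \<comment> \<open>No member of \<open>K\<close> lies strictly between \<open>f\<close> and
        \<open>g\<close>, so each one is comparable with \<open>?h\<close> by way of
        \<open>f\<close> or \<open>g\<close>.\<close>
      have "\<not> f \<succ> k" if "k \<succ> g"
        using min[OF k that] psubset_card_mono[of "supp f" "supp k"]
        unfolding enriched_greater_def by auto
      then show "?h = k \<or> ?h \<succ> k \<or> k \<succ> ?h"
        using K_comparable[OF k g] K_comparable[OF k f(1)] h(3) fh enriched_greater_trans by blast
    qed
    then show thesis
      using that h(1) v'(2) by blast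
  qed
qed

lemma ex_K_card_supp: "n \<le> d \<Longrightarrow> \<exists>f\<in>K. card (supp f) = n"
proof (induction n)
  case 0
  show ?case
    using zero_in_K by (intro bexI[of _ 0]) (auto simp: supp_def)
next
  case (Suc n)
  then obtain g where g: "g \<in> K" "card (supp g) = n"
    by auto
  then have "supp g \<noteq> UNIV"
    using Suc.prems by auto
  then obtain h v where "h \<in> K" "v \<notin> supp g" "supp h = insert v (supp g)"
    using K_successor g(1) by blast
  then show ?case
    using g(2) by (intro bexI[of _ h]) auto
qed

text \<open>The index counts the elements removed from the full poset, and \<open>K_cases\<close>
  shows that the choice is unique. For \<open>k > d\<close> truncated subtraction gives the empty
  support.\<close>

definition f where
  "f k = (SOME h. h \<in> K \<and> card (supp h) = d - k)"

lemma f_in_K: "f k \<in> K" and card_supp_f: "card (supp (f k)) = d - k"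
proof -
  have "f k \<in> K \<and> card (supp (f k)) = d - k"
    unfolding f_def by (rule someI_ex) (use ex_K_card_supp[of "d - k"] in auto)
  then show "f k \<in> K" "card (supp (f k)) = d - k"
    by auto
qed

lemma f_enriched: "f k \<in> enriched_filters"
  by (rule K_enriched[OF f_in_K])

lemma K_cases:
  assumes "h \<in> K"
  obtains k where "k \<le> d" "h = f k"
proof
  let ?k = "d - card (supp h)"
  show "?k \<le> d"
    by simp
  have "card (supp (f ?k)) = card (supp h)"
    using card_supp_f[of ?k] card_le_d[of "supp h"] by simp
  then show "h = f ?k"
    using K_comparable[OF assms f_in_K[of ?k]] psubset_card_mono[of "supp h" "supp (f ?k)"]
      psubset_card_mono[of "supp (f ?k)" "supp h"]
    unfolding enriched_greater_def by auto
qed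

lemma supp_f_psubset:
  assumes "i < j" "i < d"
  shows "supp (f j) \<subset> supp (f i)"
  using assms supp_greater_iff_card[OF f_in_K[of i] f_in_K[of j]] card_supp_f by simp

text \<open>The supports strictly above \<open>supp (f k)\<close> are those of
  \<open>f 0, ..., f (k - 1)\<close>, distinct by size, so the position of a support in the chain is
  its index.\<close>

lemma nth_filter_eq:
  assumes "i \<le> d"
  shows "nth_filter (chain_supp K) i = supp (f i)"
proof -
  have above: "card {G \<in> chain_supp K. supp (f k) \<subset> G} = k" if "k \<le> d" for k
  proof -
    have iff: "supp (f k) \<subset> supp (f j) \<longleftrightarrow> j < k" if "j \<le> d" for j
      using supp_greater_iff_card[OF f_in_K[of j] f_in_K[of k]] that \<open>k \<le> d\<close> card_supp_f by auto
    have "chain_supp K = (\<lambda>j. supp (f j)) ` {..d}"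
      unfolding chain_supp_def by (auto intro: f_in_K elim!: K_cases)
    then have "{G \<in> chain_supp K. supp (f k) \<subset> G} =
        (\<lambda>j. supp (f j)) ` {j \<in> {..d}. supp (f k) \<subset> supp (f j)}"
      by (simp only: Compr_image_eq)
    moreover have "{j \<in> {..d}. supp (f k) \<subset> supp (f j)} = {..<k}"
    proof (rule set_eqI)
      show "j \<in> {j \<in> {..d}. supp (f k) \<subset> supp (f j)} \<longleftrightarrow> j \<in> {..<k}" for j
        using that iff[of j] by (cases "j \<le> d") simp_all
    qed
    moreover have "inj_on (\<lambda>j. supp (f j)) {..<k}"
    proof (rule inj_onI)
      fix i j assume ij: "i \<in> {..<k}" "j \<in> {..<k}" and eq: "supp (f i) = supp (f j)"
      have "d - i = d - j"
        using eq card_supp_f by metis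
      then show "i = j"
        using ij that by auto
    qed
    ultimately show ?thesis
      by (simp add: card_image)
  qed
  show ?thesis
    unfolding nth_filter_def
  proof (rule the_equality)
    show "supp (f i) \<in> chain_supp K \<and> card {G \<in> chain_supp K. supp (f i) \<subset> G} = i"
      using above[OF assms] f_in_K by (auto simp: chain_supp_def)
    fix F assume F: "F \<in> chain_supp K \<and> card {G \<in> chain_supp K. F \<subset> G} = i"
    then obtain k where "k \<le> d" "F = supp (f k)"
      unfolding chain_supp_def by (auto elim: K_cases)
    then show "F = supp (f i)"
      using above F by auto
  qed
qed

section \<open>The linear extension and the sign map of the chain\<close>

abbreviation "v \<equiv> lin_ext (chain_supp K)"

lemma supp_f_step:
  assumes "i \<in> {1..d}"
  shows "supp (f (i - 1)) = insert (v i) (supp (f i))" "v i \<notin> supp (f i)"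
proof -
  have sub: "supp (f i) \<subset> supp (f (i - 1))"
    using assms by (intro supp_f_psubset) auto
  have "card (supp (f (i - 1)) - supp (f i)) = 1"
    using assms card_Diff_subset[of "supp (f i)" "supp (f (i - 1))"] sub card_supp_f by auto
  then obtain w where w: "supp (f (i - 1)) - supp (f i) = {w}"
    by (auto simp: card_1_singleton_iff)
  have "v i = w"
    unfolding lin_ext_def
  proof (rule the_equality)
    have n: "nth_filter (chain_supp K) (i - 1) = supp (f (i - 1))"
      "nth_filter (chain_supp K) i = supp (f i)"
      using assms by (auto intro!: nth_filter_eq)
    show "nth_filter (chain_supp K) (i - 1) = nth_filter (chain_supp K) i \<union> {w}"
      using w sub unfolding n by blast
    show "u = w" if "nth_filter (chain_supp K) (i - 1) = nth_filter (chain_supp K) i \<union> {u}" for u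
      using w that unfolding n by blast
  qed
  then show "supp (f (i - 1)) = insert (v i) (supp (f i))" "v i \<notin> supp (f i)"
    using w sub by blast+
qed

lemma supp_f: "k \<le> d \<Longrightarrow> supp (f k) = v ` {k<..d}"
proof (induction rule: inc_induct)
  case base
  have "card (supp (f d)) = 0"
    by (simp add: card_supp_f)
  then show ?case
    by simp
next
  case (step n)
  have "{n<..d} = insert (Suc n) {Suc n<..d}"
    using step by auto
  then show ?case
    using supp_f_step(1)[of "Suc n"] step by simp
qed

lemma surj_v: "\<exists>i\<in>{1..d}. w = v i"
proof -
  have "supp (f 0) = UNIV"
    using card_supp_f[of 0] by (intro card_subset_eq) auto
  then show ?thesis
    using supp_f[of 0] by fastforce
qed

lemma v_in_supp_f:
  assumes "i \<in> {1..d}" "k \<le> d"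
  shows "v i \<in> supp (f k) \<longleftrightarrow> k < i"
proof
  assume "v i \<in> supp (f k)"
  show "k < i"
  proof (rule ccontr)
    assume "\<not> k < i"
    then have "supp (f k) \<subseteq> supp (f i)"
      using assms supp_f by auto
    then show False
      using \<open>v i \<in> supp (f k)\<close> supp_f_step(2)[OF assms(1)] by blast
  qed
qed (use assms supp_f in auto)

text \<open>This is the linear extension property: the order filter \<open>supp (f (j - 1))\<close>
  contains \<open>v j\<close>, hence also \<open>v i\<close>.\<close>

lemma v_less_imp_less:
  assumes "i \<in> {1..d}" "j \<in> {1..d}" "v j < v i"
  shows "j < i"
proof -
  have "v j \<in> supp (f (j - 1))"
    using assms v_in_supp_f[of j "j - 1"] by auto
  then have "v i \<in> supp (f (j - 1))"
    using assms(3) enriched_filters_D(1)[OF f_enriched] unfolding order_filter_def by blast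
  then have "j \<le> i"
    using v_in_supp_f[of i "j - 1"] assms(1,2) by simp linarith
  then show ?thesis
    using assms(3) by (cases "j = i") auto
qed

text \<open>By condition (iii) of \<open>\<succ>\<close>, an element minimal in two supports has the
  same value under both functions, so the definite description is well defined.\<close>

lemma chain_sgn_eq:
  assumes "h \<in> K" "minimal_in (supp h) w"
  shows "chain_sgn K w = h $ w"
proof -
  have "k $ w = h $ w" if "k \<in> K" "minimal_in (supp k) w" for k
    using K_comparable[OF that(1) assms(1)] that assms unfolding enriched_greater_def
    by (auto simp: minimal_in_def)
  then have "(THE s. \<exists>k\<in>K. minimal_in (supp k) w \<and> s = k $ w) = h $ w"
    using assms by blast
  then show ?thesis
    unfolding chain_sgn_def using assms by auto
qed

text \<open>An element of \<open>supp (f i)\<close> below \<open>v i\<close> would force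
  \<open>v i\<close> into that order filter. With \<open>surj_v\<close>, every element is minimal in
  some support, so the sign map has no zeros.\<close>

lemma minimal_in_supp_v:
  assumes "i \<in> {1..d}"
  shows "minimal_in (supp (f (i - 1))) (v i)"
proof -
  have "\<not> w < v i" if "w \<in> supp (f i)" for w
    using that enriched_filters_D(1)[OF f_enriched] supp_f_step(2)[OF assms]
    unfolding order_filter_def by blast
  then show ?thesis
    unfolding minimal_in_def supp_f_step(1)[OF assms] by auto
qed

lemma chain_sgn_nonzero: "chain_sgn K w \<noteq> 0"
proof -
  obtain i where i: "i \<in> {1..d}" "w = v i"
    using surj_v by blast
  note m = minimal_in_supp_v[OF i(1)]
  show ?thesis
    using chain_sgn_eq[OF f_in_K m] m i(2) by (simp add: minimal_in_def supp_def)
qed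

section \<open>The functionals attached to a maximal chain\<close>

abbreviation "Chn \<equiv> assoc_chain v"

text \<open>A non-minimal element covers something and \<open>v\<close> reaches every element, so
  the index set of the recursion is empty only in the minimal case.\<close>

lemma assoc_chain_cases:
  assumes "i \<in> {1..d}"
  obtains (minimal) "minimal_in UNIV (v i)" "Chn i = {v i}"
  | (step) j where "j \<in> {1..d}" "j < i" "v j < v i" "Chn i = insert (v i) (Chn j)"
      "\<And>k. k \<in> {1..d} \<Longrightarrow> v k \<lessdot> v i \<Longrightarrow> k \<le> j"
proof (cases "minimal_in UNIV (v i)")
  case True
  then show thesis
    using minimal by (simp add: assoc_chain.simps)
next
  case False
  let ?J = "{j \<in> {1..d}. v j \<lessdot> v i}"
  obtain u where "u < v i"
    using False by (auto simp: minimal_in_def)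
  then obtain x where "x \<lessdot> v i"
    using ex_covered_by by blast
  then have ne: "?J \<noteq> {}"
    using surj_v[of x] by blast
  then have J: "Max ?J \<in> ?J"
    by (intro Max_in) auto
  then have "v (Max ?J) \<lessdot> v i"
    by blast
  then have lt: "v (Max ?J) < v i"
    unfolding covered_by_def by (rule conjunct1)
  show thesis
  proof (rule step[of "Max ?J"])
    show "Max ?J \<in> {1..d}" "v (Max ?J) < v i"
      using J lt by auto
    then show "Max ?J < i"
      using v_less_imp_less assms by blast
    show "Chn i = insert (v i) (Chn (Max ?J))"
    proof -
      have "\<not> (minimal_in UNIV (v i) \<or> ?J = {})"
        using False ne by blast
      then show ?thesis
        by (subst assoc_chain.simps) (simp only: card_UNIV_eq if_False insert_is_Un[symmetric])
    qed
    show "k \<le> Max ?J" if "k \<in> {1..d}" "v k \<lessdot> v i" for k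
      using that by (intro Max_ge) auto
  qed
qed

lemma assoc_chain:
  assumes "i \<in> {1..d}"
  shows "v i \<in> Chn i \<and> Chn i \<subseteq> {..v i} \<and> pred_on.chain UNIV (<) (Chn i)"
  using assms
proof (induction i rule: less_induct)
  case (less i)
  show ?case
    using less.prems
  proof (cases rule: assoc_chain_cases)
    case minimal
    then show ?thesis
      by (simp add: pred_on.chain_def)
  next
    case (step j)
    note IH = less.IH[OF step(2,1)]
    have "Chn j \<subseteq> {..<v i}"
      using IH step(3) by (auto dest: order.strict_trans1)
    then show ?thesis
      using IH unfolding step(4) by (auto simp: pred_on.chain_def)
  qed
qed

text \<open>Here the choice of the largest index matters. If \<open>v i\<close> is not minimal in
  the support, it covers some \<open>x\<close> in the support, whose index exceeds \<open>k\<close>.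
  The index \<open>j\<close> of the recursion is at least that of \<open>x\<close>, so the induction
  hypothesis applies to \<open>Chn j\<close>.\<close>

lemma assoc_chain_meets_minimal:
  assumes "i \<in> {1..d}" "k < i"
  shows "\<exists>w\<in>Chn i. minimal_in (supp (f k)) w"
  using assms
proof (induction i rule: less_induct)
  case (less i)
  have k: "k \<le> d"
    using less.prems by auto
  have vi: "v i \<in> supp (f k)"
    using v_in_supp_f less.prems by auto
  show ?case
  proof (cases "minimal_in (supp (f k)) (v i)")
    case True
    then show ?thesis
      using assoc_chain[OF less.prems(1)] by blast
  next
    case False
    then obtain u where u: "u < v i" "u \<in> supp (f k)"
      using vi by (auto simp: minimal_in_def)
    then obtain x where x: "x \<lessdot> v i" "u \<le> x"
      using ex_covered_by by blast
    then have "x \<in> supp (f k)"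
      using u(2) enriched_filters_D(1)[OF f_enriched] unfolding order_filter_def order_le_less by blast
    then obtain m where m: "m \<in> {1..d}" "x = v m" "k < m"
      using surj_v[of x] v_in_supp_f[OF _ k] by blast
    show ?thesis
      using less.prems(1)
    proof (cases rule: assoc_chain_cases)
      case minimal
      then show ?thesis
        using u by (auto simp: minimal_in_def)
    next
      case (step j)
      have "k < j"
        using step(5)[OF m(1)] m x by auto
      then show ?thesis
        using less.IH[OF step(2,1)] step(4) by auto
    qed
  qed
qed

lemma L_tilde_vertex:
  assumes "i \<in> {1..d}" "k \<le> d"
  shows "L_tilde K i (enriched_transfer (f k)) = (if k < i then 1 else 0)"
proof -
  let ?m = "minimal_in (supp (f k))"
  note C = assoc_chain[OF assms(1)]
  \<comment> \<open>At a minimal element both factors are the same sign; elsewhere the transferred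
    value is 0.\<close>
  have "chain_sgn K w * enriched_transfer (f k) $ w = (if ?m w then 1 else 0)" for w
  proof (cases "?m w")
    case True
    have "f k $ w * f k $ w = 1"
      using enriched_filters_D(3)[OF f_enriched True] by (metis abs_mult_self_eq mult_1)
    then show ?thesis
      using True chain_sgn_eq[OF f_in_K True]
      by (simp add: enriched_transfer_def transfer_at_enriched[OF f_enriched])
  qed (simp add: enriched_transfer_def transfer_at_enriched[OF f_enriched])
  then have L: "L_tilde K i (enriched_transfer (f k)) = (\<Sum>w\<in>Chn i. if ?m w then 1 else 0)"
    unfolding L_tilde_def by simp
  show ?thesis
  proof (cases "k < i")
    case True
    then obtain x where x: "x \<in> Chn i" "?m x"
      using assoc_chain_meets_minimal[OF assms(1)] by blast
    then have "?m w \<longleftrightarrow> w = x" if "w \<in> Chn i" for w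
      using minimal_in_chain_unique C that by blast
    then have "(\<Sum>w\<in>Chn i. if ?m w then 1 else 0 :: real) = (\<Sum>w\<in>Chn i. if w = x then 1 else 0)"
      by (intro sum.cong) auto
    then show ?thesis
      using x True L by auto
  next
    case False
    \<comment> \<open>All of \<open>Chn i\<close> lies weakly below \<open>v i\<close>, so a member
      in the order filter would pull \<open>v i\<close> into it.\<close>
    have "\<not> ?m w" if "w \<in> Chn i" for w
    proof
      assume "?m w"
      moreover have "w \<le> v i"
        using that C by blast
      ultimately have "v i \<in> supp (f k)"
        using enriched_filters_D(1)[OF f_enriched, of k]
        unfolding order_filter_def minimal_in_def order_le_less by blast
      then show False
        using v_in_supp_f[OF assms] False by blast
    qed
    then show ?thesis
      using L False by simp
  qed
qed

section \<open>Recovering a point from its functionals, and the face\<close>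

lemma linear_L_tilde: "linear (L_tilde K i)"
  by (rule linearI)
    (simp_all add: L_tilde_def algebra_simps sum.distrib sum_distrib_left)

text \<open>Triangularity: the members of \<open>Chn i\<close> other than \<open>v i\<close> lie
  strictly below it and so have smaller indices. By induction \<open>g - h\<close> vanishes on them,
  which leaves a nonzero multiple of its coordinate at \<open>v i\<close>.\<close>

lemma L_tilde_inject:
  assumes "\<And>i. i \<in> {1..d} \<Longrightarrow> L_tilde K i g = L_tilde K i h"
  shows "g = h"
proof -
  have coord: "(g - h) $ v i = 0" if "i \<in> {1..d}" for i
    using that
  proof (induction i rule: less_induct)
    case (less i)
    note C = assoc_chain[OF less.prems]
    have zero: "(g - h) $ w = 0" if "w \<in> Chn i - {v i}" for w
    proof -
      obtain j where j: "j \<in> {1..d}" "w = v j"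
        using surj_v by blast
      have "w < v i"
        using that C by auto
      then show ?thesis
        using less.IH[of j] v_less_imp_less less.prems j by blast
    qed
    have "0 = L_tilde K i (g - h)"
      using assms[OF less.prems] linear_diff[OF linear_L_tilde] by simp
    also have "\<dots> = chain_sgn K (v i) * (g - h) $ v i
        + (\<Sum>w\<in>Chn i - {v i}. chain_sgn K w * (g - h) $ w)"
      unfolding L_tilde_def using C by (intro sum.remove) auto
    also have "\<dots> = chain_sgn K (v i) * (g - h) $ v i"
      using zero by (simp add: sum.neutral)
    finally show ?case
      using chain_sgn_nonzero by simp
  qed
  have "g $ w = h $ w" for w
    using surj_v[of w] coord by auto
  then show ?thesis
    by (simp add: vec_eq_iff)
qed

lemma enriched_face_eq:
  "enriched_face K =
     {g. 0 \<le> L_tilde K 1 g \<and>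
         (\<forall>i \<in> {1..<d}. L_tilde K i g \<le> L_tilde K (i + 1) g) \<and>
         L_tilde K d g \<le> 1}"
  (is "_ = ?S")
proof
  note d = d_ge_1
  show "enriched_face K \<subseteq> ?S"
    unfolding enriched_face_def
  proof (rule hull_minimal)
    \<comment> \<open>At a vertex the functionals take values 0 first and 1 afterwards, a weakly
      increasing sequence.\<close>
    show "enriched_transfer ` K \<subseteq> ?S"
      using d by (auto simp: L_tilde_vertex elim!: K_cases)
    show "convex ?S"
    proof (rule convexI)
      fix x y and a b :: real
      assume xy: "x \<in> ?S" "y \<in> ?S" and ab: "0 \<le> a" "0 \<le> b" "a + b = 1"
      have L: "L_tilde K i (a *\<^sub>R x + b *\<^sub>R y) = a * L_tilde K i x + b * L_tilde K i y" for i
        by (simp add: linear_add[OF linear_L_tilde] linear_scale[OF linear_L_tilde])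
      have "a * L_tilde K d x + b * L_tilde K d y \<le> 1"
        using xy ab by (intro convex_bound_le) auto
      then show "a *\<^sub>R x + b *\<^sub>R y \<in> ?S"
        using xy ab by (auto simp: L intro!: add_mono mult_left_mono add_nonneg_nonneg)
    qed
  qed
  show "?S \<subseteq> enriched_face K"
  proof
    fix g assume g: "g \<in> ?S"
    \<comment> \<open>\<open>l\<close> pads the functional values with 0 in front and 1 behind. Its
      differences \<open>c\<close> are the barycentric coordinates: the inequalities in
      \<open>?S\<close> say that they are nonnegative, and they telescope to 1.\<close>
    define l where "l i = (if i = 0 then 0 else if i \<le> d then L_tilde K i g else 1)" for i
    define c where "c k = l (Suc k) - l k" for k
    have "0 \<le> c k" if k: "k \<le> d" for k
    proof -
      consider "k = 0" | "k \<in> {1..<d}" | "k = d"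
        using k by fastforce
      then show ?thesis
        using g d by cases (auto simp: c_def l_def)
    qed
    moreover have tel: "(\<Sum>k<n. c k) = l n" for n
      unfolding c_def by (subst sum_lessThan_telescope) (simp add: l_def)
    have "(\<Sum>k\<le>d. c k) = 1"
      using tel[of "Suc d"] by (simp add: lessThan_Suc_atMost l_def)
    moreover have "enriched_transfer (f k) \<in> enriched_face K" for k
      unfolding enriched_face_def using f_in_K by (simp add: hull_inc)
    moreover have "convex (enriched_face K)"
      by (simp add: enriched_face_def)
    ultimately have mem: "(\<Sum>k\<le>d. c k *\<^sub>R enriched_transfer (f k)) \<in> enriched_face K" (is "?h \<in> _")
      by (intro convex_sum) auto
    have "?h = g"
    proof (rule L_tilde_inject)
      fix i assume i: "i \<in> {1..d}"
      have "L_tilde K i ?h = (\<Sum>k\<le>d. c k * L_tilde K i (enriched_transfer (f k)))"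
        by (simp add: linear_sum[OF linear_L_tilde] linear_scale[OF linear_L_tilde])
      \<comment> \<open>Only vertices with \<open>k < i\<close> contribute, so the sum telescopes to
        \<open>l i\<close>.\<close>
      also have "\<dots> = (\<Sum>k\<le>d. if k < i then c k else 0)"
        using L_tilde_vertex[OF i] by (intro sum.cong) auto
      also have "\<dots> = (\<Sum>k<i. c k)"
        using i by (intro sum.mono_neutral_cong_right) auto
      also have "\<dots> = L_tilde K i g"
        using i tel by (simp add: l_def)
      finally show "L_tilde K i ?h = L_tilde K i g" .
    qed
    then show "g \<in> enriched_face K"
      using mem by simp
  qed
qed

end

theorem corollary3p16:
  fixes K :: "(real ^ 'a::{finite, order}) set" and d :: nat
  assumes "CARD('a) = d"
    and "pred_on.maxchain enriched_filters (\<succ>) K"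
  shows "enriched_face K \<in> enriched_triangulation \<and>
         enriched_face K =
           {g. 0 \<le> L_tilde K 1 g \<and>
               (\<forall>i \<in> {1..<d}. L_tilde K i g \<le> L_tilde K (i + 1) g) \<and>
               L_tilde K d g \<le> 1}"
proof
  show "enriched_face K \<in> enriched_triangulation"
    using assms(2) unfolding enriched_triangulation_def pred_on.maxchain_def by blast
  interpret enriched_maxchain K d
    by unfold_locales (rule assms)+
  show "enriched_face K =
           {g. 0 \<le> L_tilde K 1 g \<and>
               (\<forall>i \<in> {1..<d}. L_tilde K i g \<le> L_tilde K (i + 1) g) \<and>
               L_tilde K d g \<le> 1}"
    by (rule enriched_face_eq)
qed

end
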